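(* For every integer $n\ge1$, $$V_n(10)=\begin{cases}6\cdot5^{n/2}\left[(2\cdot15^n+12^n+2\cdot60^n)L_n+60^nL_{5n}\right], & n\text{ even},\\[2mm] 6\cdot5^{(n+1)/2}\left[(2\cdot15^n+12^n+2\cdot60^n)F_n+60^nF_{5n}\right], & n\text{ odd}.\end{cases}$$
   Context: For integers $n\ge1$, $m\ge3$, the $\mathrm{SU}(3)$ Verlinde sum is $$V_n(m)=3^nm^{2n}\sum_{\substack{(j,\ell,k)\in(\mathbb Z/m\mathbb Z\setminus\{0\})^3\\ j+\ell+k\equiv 0 \bmod m}}\Big(8\sin\frac{\pi j}{m}\sin\frac{\pi\ell}{m}\sin\frac{\pi k}{m}\Big)^{-2n}.$$ $F_n$ is the $n$th Fibonacci number ($F_1=F_2=1$, $F_{n+1}=F_n+F_{n-1}$) and $L_n$ is the $n$th Lucas number ($L_1=1$, $L_2=3$, $L_{n+1}=L_n+L_{n-1}$). *)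

theory Defs
  imports "HOL-Analysis.Analysis" "HOL-Number_Theory.Fib"
begin

text \<open>
  Nonzero residue classes modulo \<open>m\<close> are represented by \<open>1, \<dots>, m - 1\<close>. Changing a representative
  by a multiple of \<open>m\<close> changes the corresponding sine only by a sign, which the even exponent
  \<open>-2n\<close> removes. All three sines are nonzero on this range.
\<close>

definition verlinde_index :: "nat \<Rightarrow> (nat \<times> nat \<times> nat) set" where
  "verlinde_index m =
     {(j, l, k). j \<in> {1..<m} \<and> l \<in> {1..<m} \<and> k \<in> {1..<m} \<and> (j + l + k) mod m = 0}"

definition verlinde_SU3 :: "nat \<Rightarrow> nat \<Rightarrow> real" where
  "verlinde_SU3 n m =
     3 ^ n * real m ^ (2 * n) *
     (\<Sum>(j, l, k)\<in>verlinde_index m.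
        (8 * sin (pi * real j / real m) * sin (pi * real l / real m) * sin (pi * real k / real m))
          powi (- 2 * int n))"

text \<open>The value at \<open>0\<close> extends the recurrence backwards, so that \<open>lucas 1 = 1\<close> and \<open>lucas 2 = 3\<close>.\<close>

fun lucas :: "nat \<Rightarrow> nat" where
  "lucas 0 = 2"
| "lucas (Suc 0) = 1"
| "lucas (Suc (Suc n)) = lucas (Suc n) + lucas n"

lemma finite_verlinde_index: "finite (verlinde_index m)"
  by (rule finite_subset[of _ "{1..<m} \<times> {1..<m} \<times> {1..<m}"]) (auto simp: verlinde_index_def)

end

(*
  Let phi be the golden ratio. The numbers 4 sin^2(pi j / 10) for j = 1, ..., 5 are
  phi^-2, sqrt 5 phi^-1, phi^2, sqrt 5 phi and 4, so 300 divided by the product of the three factors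
  of an index triple is always sqrt 5 times 12, 15 or 60 times one of phi, phi^-1, phi^5, phi^-5.
  Since phi^-1 is minus the conjugate of phi, phi^n + phi^-n is L_n for even n and
  sqrt 5 F_n for odd n.
*)

theory Submission
  imports Defs
begin

section \<open>Enumeration of the index triples\<close>

lemma mod_eq_0_iff_less_three_mult:
  fixes m s :: nat
  assumes "0 < s" "s < 3 * m"
  shows "s mod m = 0 \<longleftrightarrow> s = m \<or> s = 2 * m"
proof
  assume "s mod m = 0"
  then obtain q where q: "s = m * q" by (auto elim: dvdE)
  with assms have "0 < q" "q < 3" by auto
  then have "q = 1 \<or> q = 2" by auto
  with q show "s = m \<or> s = 2 * m" by auto
qed auto

text \<open>
  The entries of an index triple sum to \<open>m\<close> or to \<open>2 * m\<close>. Reflecting the last entry in the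
  first case, and the first two in the second, gives \<open>k = j + l\<close> in both.
\<close>

lemma sum_verlinde_index:
  fixes w :: "nat \<Rightarrow> 'a" and f :: "'a \<Rightarrow> 'a \<Rightarrow> 'a \<Rightarrow> real"
  assumes w: "\<And>j. j \<le> m \<Longrightarrow> w (m - j) = w j"
  shows "(\<Sum>(j, l, k)\<in>verlinde_index m. f (w j) (w l) (w k)) =
    2 * (\<Sum>(j, l)\<in>(SIGMA j:{1..<m}. {1..<m - j}). f (w j) (w l) (w (j + l)))"
    (is "sum ?g _ = 2 * ?S")
proof -
  define V where "V s = 
    {t \<in> {1..<m} \<times> {1..<m} \<times> {1..<m}. case t of (j, l, k) \<Rightarrow> j + l + k = s}" for s
  have "verlinde_index m = V m \<union> V (2 * m)"
  proof (rule set_eqI)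
    fix t :: "nat \<times> nat \<times> nat"
    obtain j l k where t: "t = (j, l, k)" by (cases t)
    have "(j + l + k) mod m = 0 \<longleftrightarrow> j + l + k = m \<or> j + l + k = 2 * m"
      if "j \<in> {1..<m} \<and> l \<in> {1..<m} \<and> k \<in> {1..<m}"
      using that by (intro mod_eq_0_iff_less_three_mult) auto
    then show "t \<in> verlinde_index m \<longleftrightarrow> t \<in> V m \<union> V (2 * m)"
      unfolding verlinde_index_def V_def t Un_iff mem_Collect_eq mem_Sigma_iff prod.case by argo
  qed
  moreover have "V m \<inter> V (2 * m) = {}"
    by (auto simp: V_def)
  moreover have "finite (V s)" for s
    by (simp add: V_def)
  ultimately have "sum ?g (verlinde_index m) = sum ?g (V m) + sum ?g (V (2 * m))"
    by (simp add: sum.union_disjoint)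
  moreover have "sum ?g (V m) = ?S"
  proof (rule sum.reindex_bij_witness[where i = "\<lambda>(j, l). (j, l, m - (j + l))"
        and j = "\<lambda>(j, l, k). (j, l)"])
    fix t assume "t \<in> V m"
    then obtain j l k where t: "t = (j, l, k)" "k = m - (j + l)" "j + l \<le> m"
      by (auto simp: V_def)
    with w[of "j + l"]
    show "(case case t of (j, l, k) \<Rightarrow> (j, l) of (j, l) \<Rightarrow> f (w j) (w l) (w (j + l))) = ?g t"
      by simp
  qed (auto simp: V_def)
  moreover have "sum ?g (V (2 * m)) = ?S"
  proof (rule sum.reindex_bij_witness[where i = "\<lambda>(j, l). (m - j, m - l, j + l)"
        and j = "\<lambda>(j, l, k). (m - j, m - l)"])
    fix t assume "t \<in> V (2 * m)"
    then obtain j l k where t: "t = (j, l, k)" "k = (m - j) + (m - l)" "j \<le> m" "l \<le> m"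
      by (auto simp: V_def)
    with w[of j] w[of l]
    show "(case case t of (j, l, k) \<Rightarrow> (m - j, m - l) of (j, l) \<Rightarrow> f (w j) (w l) (w (j + l))) = ?g t"
      by (simp add: add.commute)
  qed (auto simp: V_def)
  ultimately show ?thesis by simp
qed

text \<open>There are 36 pairs with \<open>j + l < 10\<close>. Folding the indices 6 to 9 onto 4 to
  1 and ignoring the order of the factors leaves eight products; the coefficients add up to 2 * 36 =
  72.\<close>

lemma sum_verlinde_index_10:
  fixes w :: "nat \<Rightarrow> 'a::comm_monoid_mult" and f :: "'a \<Rightarrow> real"
  assumes w: "\<And>j. j \<le> 10 \<Longrightarrow> w (10 - j) = w j"
  shows "(\<Sum>(j, l, k)\<in>verlinde_index 10. f (w j * w l * w k)) =
    6 * f (w 1 * w 1 * w 2) + 12 * f (w 1 * w 2 * w 3) + 12 * f (w 1 * w 3 * w 4)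
    + 12 * f (w 1 * w 4 * w 5) + 6 * f (w 2 * w 2 * w 4) + 12 * f (w 2 * w 3 * w 5)
    + 6 * f (w 2 * w 4 * w 4) + 6 * f (w 3 * w 3 * w 4)"
proof -
  have w': "w 6 = w 4" "w 7 = w 3" "w 8 = w 2" "w 9 = w 1"
    using w[of 4] w[of 3] w[of 2] w[of 1] by simp_all
  have "(\<Sum>(j, l, k)\<in>verlinde_index 10. f (w j * w l * w k)) =
    2 * (\<Sum>j = 1..<10. \<Sum>l = 1..<10 - j. f (w j * w l * w (j + l)))"
    using sum_verlinde_index[of 10 w "\<lambda>x y z. f (x * y * z)", OF w] by (simp add: sum.Sigma)
  \<comment> \<open>Unrolls sums over intervals with literal bounds. The index must stay the numeral
    1 instead of \<open>Suc 0\<close> for the terms to match.\<close>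
  moreover have peel: "sum g {a..<b} = g a + sum g {a + 1..<b}" if "a < b"
    for g :: "nat \<Rightarrow> real" and a b
    using that by (simp add: sum.atLeast_Suc_lessThan)
  ultimately show ?thesis
    by (simp add: peel w' mult_ac del: One_nat_def)
qed

section \<open>The golden ratio and the sines of multiples of pi / 10\<close>

definition golden :: real where "golden = (1 + sqrt 5) / 2"

lemma golden_pos: "golden > 0"
  by (simp add: golden_def add_pos_nonneg)

lemma golden_sq: "golden\<^sup>2 = golden + 1"
  by (simp add: golden_def power2_eq_square field_simps)

lemma sqrt5_eq_golden: "sqrt 5 = 2 * golden - 1"
  by (simp add: golden_def field_simps)

lemma inverse_golden: "inverse golden = golden - 1"
proof -
  have "golden * (golden - 1) = 1"
    using golden_sq by (simp add: power2_eq_square algebra_simps)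
  then show ?thesis by (metis inverse_unique)
qed

text \<open>Twice and three times pi / 10 are complementary angles, so sin 2x = cos 3x; cancelling
  cos x leaves a quadratic equation for sin x.\<close>

lemma sin_pi_10: "sin (pi / 10) = inverse golden / 2"
proof -
  let ?s = "sin (pi / 10)" and ?c = "cos (pi / 10)"
  have c: "?c > 0" by (intro cos_gt_zero_pi) (use pi_gt_zero in auto)
  have s: "?s > 0" by (intro sin_gt_zero) (use pi_gt_zero in auto)
  have "sin (2 * (pi / 10)) = cos (3 * (pi / 10))"
    by (simp add: sin_cos_eq field_simps)
  then have "2 * ?s * ?c = 4 * ?c ^ 3 - 3 * ?c"
    by (simp only: sin_double cos_treble_cos)
  then have "?c * (2 * ?s) = ?c * (4 * ?c\<^sup>2 - 3)"
    by (simp add: power3_eq_cube power2_eq_square algebra_simps)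
  then have "2 * ?s = 4 * ?c\<^sup>2 - 3" using c by simp
  then have "4 * ?s\<^sup>2 + 2 * ?s - 1 = 0"
    by (simp add: cos_squared_eq)
  \<comment> \<open>In t = 2 sin x the quadratic is t^2 + t - 1, with roots
    \<open>inverse golden\<close> and \<open>- golden\<close>; positivity selects the first.\<close>
  then have "(2 * ?s - inverse golden) * (2 * ?s + golden) = 0"
    unfolding inverse_golden using golden_sq by (simp add: power2_eq_square algebra_simps)
  moreover have "2 * ?s + golden > 0" using s golden_pos by simp
  ultimately show ?thesis by simp
qed

text \<open>For \<open>j \<le> 10\<close>, the squared length of a chord spanning j sides of the
  regular decagon in the unit circle. Squaring turns the exponent -2n into -n.\<close>

definition chord_sq :: "nat \<Rightarrow> real" where
  "chord_sq j = (2 * sin (pi * real j / 10))\<^sup>2"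

lemma chord_sq_reflect: "j \<le> 10 \<Longrightarrow> chord_sq (10 - j) = chord_sq j"
proof -
  assume "j \<le> 10"
  then have "pi * real (10 - j) / 10 = pi - pi * real j / 10" by (simp add: field_simps)
  then show ?thesis unfolding chord_sq_def by (simp only: sin_pi_minus)
qed

lemma chord_sq_complement: "j \<le> 5 \<Longrightarrow> chord_sq (5 - j) = 4 - chord_sq j"
proof -
  assume "j \<le> 5"
  then have "pi * real (5 - j) / 10 = pi / 2 - pi * real j / 10" by (simp add: field_simps)
  then have "sin (pi * real (5 - j) / 10) = cos (pi * real j / 10)"
    by (simp only: cos_sin_eq of_real_eq_id id_apply)
  then show ?thesis by (simp add: chord_sq_def power_mult_distrib cos_squared_eq)
qed

lemma chord_sq_double: "chord_sq (2 * j) = chord_sq j * (4 - chord_sq j)"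
proof -
  have "pi * real (2 * j) / 10 = 2 * (pi * real j / 10)" by simp
  then have "sin (pi * real (2 * j) / 10) = 2 * sin (pi * real j / 10) * cos (pi * real j / 10)"
    by (metis sin_double)
  then show ?thesis
    by (simp add: chord_sq_def power_mult_distrib cos_squared_eq algebra_simps)
qed

text \<open>Only the sine of pi / 10 is needed: doubling the angle leads from 1 to 2, and
  complements lead from 2, 1, 0 to 3, 4, 5.\<close>

lemma chord_sq_values:
  "chord_sq 1 = inverse golden ^ 2" "chord_sq 2 = sqrt 5 * inverse golden"
  "chord_sq 3 = golden ^ 2" "chord_sq 4 = sqrt 5 * golden" "chord_sq 5 = 4"
proof -
  \<comment> \<open>Rewrite rules reducing polynomials in \<open>golden\<close> to degree one; the
    second reaches into right-nested products.\<close>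
  have golden_mult: "golden * golden = golden + 1" "golden * (golden * x) = golden * x + x" for x
    using golden_sq by (simp_all add: power2_eq_square algebra_simps flip: mult.assoc)
  show 1: "chord_sq 1 = inverse golden ^ 2"
    by (simp add: chord_sq_def sin_pi_10)
  show 2: "chord_sq 2 = sqrt 5 * inverse golden"
    using chord_sq_double[of 1] unfolding 1 mult_1_right sqrt5_eq_golden inverse_golden
    by (simp add: golden_mult power2_eq_square algebra_simps)
  show "chord_sq 3 = golden ^ 2"
    using chord_sq_complement[of 2] unfolding 2 sqrt5_eq_golden inverse_golden
    by (simp add: golden_mult power2_eq_square algebra_simps)
  show "chord_sq 4 = sqrt 5 * golden"
    using chord_sq_complement[of 1] unfolding 1 sqrt5_eq_golden inverse_golden
    by (simp add: golden_mult power2_eq_square algebra_simps)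
  show "chord_sq 5 = 4"
    using chord_sq_complement[of 0] by (simp add: chord_sq_def)
qed

section \<open>Lucas and Fibonacci numbers as sums of powers\<close>

lemma lucas_closed_form: "real (lucas n) = golden ^ n + (- inverse golden) ^ n"
proof (induction n rule: lucas.induct)
  case 2
  then show ?case by (simp add: inverse_golden)
next
  case (3 n)
  \<comment> \<open>Both \<open>golden\<close> and \<open>- inverse golden\<close> are roots of x^2
    = x + 1, so their powers satisfy the Lucas recurrence.\<close>
  have "golden * (golden * golden ^ n) = (golden + 1) * golden ^ n"
    using golden_sq by (simp add: power2_eq_square flip: mult.assoc)
  moreover have "inverse golden * inverse golden = 1 - inverse golden"
    using golden_sq by (simp add: inverse_golden power2_eq_square algebra_simps)
  then have "inverse golden * (inverse golden * (- inverse golden) ^ n)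
      = (1 - inverse golden) * (- inverse golden) ^ n"
    by (simp flip: mult.assoc)
  ultimately show ?case
    using 3 by (simp add: algebra_simps)
qed simp

lemma golden_power_sum:
  "golden ^ n + inverse golden ^ n = (if even n then real (lucas n) else sqrt 5 * real (fib n))"
proof -
  \<comment> \<open>Brings the conjugate root in Binet's formula into the form used for the Lucas
    numbers.\<close>
  have psi: "(1 - sqrt 5) / 2 = - inverse golden"
    by (simp add: inverse_golden sqrt5_eq_golden)
  have "sqrt 5 * real (fib n) = golden ^ n - (- inverse golden) ^ n"
    unfolding fib_closed_form psi by (simp flip: golden_def)
  then show ?thesis
    by (simp add: lucas_closed_form)
qed

section \<open>Evaluation of the Verlinde sum\<close>

lemma verlinde_SU3_10_chord:
  "verlinde_SU3 n 10 =
    (\<Sum>(j, l, k)\<in>verlinde_index 10. (300 / (chord_sq j * chord_sq l * chord_sq k)) ^ n)"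
proof -
  have powi: "x powi (- 2 * int n) = inverse (x\<^sup>2) ^ n" for x :: real
  proof -
    have "- 2 * int n = - int (2 * n)" by simp
    then show ?thesis
      by (simp only: power_int_minus power_int_of_nat power_mult power_inverse)
  qed
  have "(300 / (chord_sq j * chord_sq l * chord_sq k)) ^ n =
      3 ^ n * 10 ^ (2 * n) *
      (8 * sin (pi * real j / 10) * sin (pi * real l / 10) * sin (pi * real k / 10)) powi (- 2 * int n)"
      (is "_ = _ * ?x powi _") for j l k
  proof -
    have "chord_sq j * chord_sq l * chord_sq k = ?x\<^sup>2"
      by (simp add: chord_sq_def power_mult_distrib)
    moreover have "(300 / y) ^ n = 3 ^ n * (10\<^sup>2) ^ n * inverse y ^ n" for y :: real
    proof -
      have "300 / y = 3 * 10\<^sup>2 * inverse y" by (simp add: divide_inverse)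
      then show ?thesis by (simp only: power_mult_distrib)
    qed
    ultimately show ?thesis
      unfolding powi power_mult by (simp only:)
  qed
  then show ?thesis
    by (simp only: verlinde_SU3_def sum_distrib_left case_prod_unfold of_nat_numeral)
qed

text \<open>Each triple has one or three even indices, and each of these contributes a factor
  \<open>sqrt 5\<close>. One such factor gives 300 / sqrt 5 = 60 sqrt 5, or 15 sqrt 5 if
  \<open>chord_sq 5 = 4\<close> also occurs; three give 12 sqrt 5.\<close>

lemma chord_sq_products:
  "300 / (chord_sq 1 * chord_sq 1 * chord_sq 2) = sqrt 5 * (60 * golden ^ 5)"
  "300 / (chord_sq 1 * chord_sq 2 * chord_sq 3) = sqrt 5 * (60 * golden)"
  "300 / (chord_sq 1 * chord_sq 3 * chord_sq 4) = sqrt 5 * (60 * inverse golden)"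
  "300 / (chord_sq 1 * chord_sq 4 * chord_sq 5) = sqrt 5 * (15 * golden)"
  "300 / (chord_sq 2 * chord_sq 2 * chord_sq 4) = sqrt 5 * (12 * golden)"
  "300 / (chord_sq 2 * chord_sq 3 * chord_sq 5) = sqrt 5 * (15 * inverse golden)"
  "300 / (chord_sq 2 * chord_sq 4 * chord_sq 4) = sqrt 5 * (12 * inverse golden)"
  "300 / (chord_sq 3 * chord_sq 3 * chord_sq 4) = sqrt 5 * (60 * inverse golden ^ 5)"
  unfolding chord_sq_values using golden_pos
  by (simp_all add: field_simps eval_nat_numeral)

theorem mainTheorem7:
  fixes n :: nat
  assumes "n \<ge> 1"
  shows "verlinde_SU3 n 10 =
    (if even n
     then 6 * 5 ^ (n div 2) *
            ((2 * 15 ^ n + 12 ^ n + 2 * 60 ^ n) * real (lucas n) + 60 ^ n * real (lucas (5 * n)))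
     else 6 * 5 ^ ((n + 1) div 2) *
            ((2 * 15 ^ n + 12 ^ n + 2 * 60 ^ n) * real (fib n) + 60 ^ n * real (fib (5 * n))))"
proof -
  \<comment> \<open>The eight terms form four pairs with equal coefficients and reciprocal powers of
    \<open>golden\<close>.\<close>
  define K where "K k = golden ^ k + inverse golden ^ k" for k
  have V: "verlinde_SU3 n 10 =
      6 * sqrt 5 ^ n * ((2 * 15 ^ n + 12 ^ n + 2 * 60 ^ n) * K n + 60 ^ n * K (5 * n))"
    using sum_verlinde_index_10[of chord_sq "\<lambda>p. (300 / p) ^ n", OF chord_sq_reflect]
    unfolding verlinde_SU3_10_chord chord_sq_products power_mult_distrib K_def power_mult
    by (simp only:) (simp add: algebra_simps)
  show ?thesis
  \<comment> \<open>As 5n has the parity of n, one case distinction settles both \<open>K n\<close>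
    and \<open>K (5 * n)\<close>.\<close>
  proof (cases "even n")
    case True
    then have "sqrt 5 ^ n = 5 ^ (n div 2)"
      by (auto elim!: evenE simp: power_mult)
    with True V show ?thesis
      by (simp add: K_def golden_power_sum)
  next
    case False
    \<comment> \<open>The extra \<open>sqrt 5\<close> comes from the Fibonacci case of
      \<open>golden_power_sum\<close> and completes an integral power of 5.\<close>
    then have root: "sqrt 5 ^ n * sqrt 5 = 5 ^ ((n + 1) div 2)"
      by (auto elim!: oddE simp: power_mult)
    have "verlinde_SU3 n 10 = 6 * (sqrt 5 ^ n * sqrt 5) *
        ((2 * 15 ^ n + 12 ^ n + 2 * 60 ^ n) * real (fib n) + 60 ^ n * real (fib (5 * n)))"
      using False V by (simp add: K_def golden_power_sum algebra_simps)
    with False show ?thesis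
      by (simp only: root if_False)
  qed
qed

end
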